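(* Let $a,b,c$ be integers with $2\le a<b<c$ and $c\ge2(a+b)$; put $S=\{a,b,c\}$, $B=\{a,b\}$ and $\rho=c\bmod(a+b)$. Then $\mathcal G_S$ is purely periodic with least period $p\le a+b$ if and only if $\rho\in\Theta_{a+b}$. In that case $\mathcal W_0(S)=\mathcal W_0(B)$, and $p$ is the least period of $\mathcal G_B$, a divisor of $a+b$.
   Context: $\mathbb N=\{0,1,2,\dots\}$. For a finite nonempty set $S$ of positive integers, the subtraction game $S$ has positions $x\in\mathbb N$ and legal moves $x\mapsto x-s$ for $s\in S$, $s\le x$; a player unable to move loses. The nim-value is $\mathcal G_S(x)=\operatorname{mex}\{\mathcal G_S(x-s):s\in S,\ s\le x\}$, where mex is the least non-negative integer not in the set, and $\mathcal W_0(S)=\{x\in\mathbb N:\mathcal G_S(x)=0\}$ is the set of $\mathrm P$-positions. $\mathcal G_S$ is purely periodic if there is $p\ge1$ with $\mathcal G_S(x+p)=\mathcal G_S(x)$ for all $x\ge0$; the least such $p$ is the least period. Put $\mathcal Z=\mathcal W_0(\{a,b\})\cap[0,a+b)$ where $[0,a+b)=\{0,\dots,a+b-1\}$, viewed as a subset of $\mathbb Z/(a+b)\mathbb Z$. Then $\Theta_{a+b}=\{\rho\in\mathbb Z/(a+b)\mathbb Z:\mathcal Z\cap(\mathcal Z+\rho)=\varnothing\}$, the translate being read modulo $a+b$. *)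

theory Defs
  imports Main
begin

definition mex :: "nat set \<Rightarrow> nat" where
  "mex A = (LEAST n. n \<notin> A)"

(* Subtraction sets consist of positive integers; the guard 0 < s is vacuous for them
   and only makes the recursion total on all sets. *)
function nim_value :: "nat set \<Rightarrow> nat \<Rightarrow> nat" where
  "nim_value S x = mex ((\<lambda>s. nim_value S (x - s)) ` {s \<in> S. 0 < s \<and> s \<le> x})"
  by auto
termination
  by (relation "measure snd") auto

declare nim_value.simps [simp del]

definition P_positions :: "nat set \<Rightarrow> nat set" where
  "P_positions S = {x. nim_value S x = 0}"

definition is_pure_period :: "(nat \<Rightarrow> 'a) \<Rightarrow> nat \<Rightarrow> bool" where
  "is_pure_period f p \<longleftrightarrow> 1 \<le> p \<and> (\<forall>x. f (x + p) = f x)"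

definition purely_periodic_with_least_period :: "(nat \<Rightarrow> 'a) \<Rightarrow> nat \<Rightarrow> bool" where
  "purely_periodic_with_least_period f p \<longleftrightarrow>
     is_pure_period f p \<and> (\<forall>q. is_pure_period f q \<longrightarrow> p \<le> q)"

definition P_residues :: "nat \<Rightarrow> nat \<Rightarrow> nat set" where
  "P_residues a b = P_positions {a, b} \<inter> {0..<a + b}"

(* Residue classes modulo n are represented by their least non-negative
   representatives, i.e. by the elements of {0..<n}. *)
definition translate_mod :: "nat \<Rightarrow> nat set \<Rightarrow> nat \<Rightarrow> nat set" where
  "translate_mod n Z \<rho> = (\<lambda>z. (z + \<rho>) mod n) ` Z"

definition Theta :: "nat \<Rightarrow> nat \<Rightarrow> nat set" where
  "Theta a b = {\<rho> \<in> {0..<a + b}.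
     P_residues a b \<inter> translate_mod (a + b) (P_residues a b) \<rho> = {}}"

end

(* Write n = a + b.  The zero set of G_B is n-periodic, and by Ferguson's pairing property
   (G(x) = 1 iff G(x - a) = 0, where a is the smallest move) so is G_B itself, with values
   in {0, 1, 2}.
   If \<rho> lies in Theta, then no move by c joins two zeros of G_B, so both games have the same zeros
   and hence the same ones; a move by c joining two positions of value 2 would join the two
   zeros lying b below them, so the value 3 never occurs and G_S = G_B.
   Conversely G_S and G_B agree below c, an interval of length at least 2n.  A period p \<le> n of G_S
   is therefore a period of G_B, so G_S = G_B, and then a move by c cannot join two zeros. *)
theory Submission
  imports Defs
begin

section \<open>Mex and nim-values of subtraction games\<close>

lemma mex_notin: "finite A \<Longrightarrow> mex A \<notin> A"
  unfolding mex_def using ex_new_if_finite[OF infinite_UNIV_nat] by (rule LeastI_ex)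

lemma less_mex: "m < mex A \<Longrightarrow> m \<in> A"
  unfolding mex_def using not_less_Least by blast

lemma nim_value_move:
  assumes "s \<in> S" and "0 < s" and "s \<le> x"
  shows "nim_value S (x - s) \<noteq> nim_value S x"
proof -
  have "finite {s \<in> S. 0 < s \<and> s \<le> x}"
    by (rule finite_subset[of _ "{..x}"]) auto
  then have "nim_value S x \<notin> (\<lambda>s. nim_value S (x - s)) ` {s \<in> S. 0 < s \<and> s \<le> x}"
    by (subst nim_value.simps) (intro mex_notin finite_imageI)
  then show ?thesis
    using assms by force
qed

lemma less_nim_value:
  assumes "m < nim_value S x"
  obtains s where "s \<in> S" "0 < s" "s \<le> x" "nim_value S (x - s) = m"
proof -
  have "m < mex ((\<lambda>s. nim_value S (x - s)) ` {s \<in> S. 0 < s \<and> s \<le> x})"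
    using assms by (subst (asm) nim_value.simps)
  from less_mex[OF this] show ?thesis
    using that by auto
qed

lemma nim_value_eq_0:
  assumes "\<And>s. s \<in> S \<Longrightarrow> 0 < s \<Longrightarrow> s \<le> x \<Longrightarrow> nim_value S (x - s) \<noteq> 0"
  shows "nim_value S x = 0"
  using assms less_nim_value[of 0 S x] by (metis neq0_conv)

lemma nim_value_below:
  assumes "\<And>s. s \<in> S \<Longrightarrow> x < s"
  shows "nim_value S x = 0"
  using assms by (intro nim_value_eq_0) (meson not_le)

text \<open>Play from \<open>x\<close> stays at or below \<open>x\<close>, so only moves of length
  at most \<open>x\<close> can ever be made. Games that differ only in a large move therefore agree
  below it.\<close>

lemma nim_value_cong:
  assumes "\<And>s. 0 < s \<Longrightarrow> s \<le> x \<Longrightarrow> s \<in> S \<longleftrightarrow> s \<in> T"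
  shows "nim_value S x = nim_value T x"
  using assms
proof (induction x rule: less_induct)
  case (less x)
  have "{s \<in> S. 0 < s \<and> s \<le> x} = {s \<in> T. 0 < s \<and> s \<le> x}"
    using less.prems by auto
  moreover have "nim_value S (x - s) = nim_value T (x - s)" if "0 < s" "s \<le> x" for s
    using that less.prems by (intro less.IH) auto
  ultimately show ?case
    by (subst (1 2) nim_value.simps) (auto intro!: arg_cong[where f = mex] image_cong)
qed

text \<open>The moves \<open>a\<close> and \<open>s\<close> commute. If \<open>x\<close> has value 1
  and \<open>s\<close> led from \<open>x - a\<close> to a zero, induction would give
  \<open>x - s\<close> value 1 as well. If \<open>x - a\<close> is a zero and \<open>x\<close>
  exceeded 1, some \<open>x - s\<close> would have value 1, so by induction \<open>s\<close> would
  lead from \<open>x - a\<close> to a zero. Minimality of \<open>a\<close> makes positions below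
  \<open>a\<close> terminal, so none of them has value 1.\<close>

lemma ferguson_pairing:
  assumes "a \<in> S" and "0 < a" and min: "\<And>s. s \<in> S \<Longrightarrow> a \<le> s"
  shows "nim_value S x = 1 \<longleftrightarrow> a \<le> x \<and> nim_value S (x - a) = 0"
proof (induction x rule: less_induct)
  case (less x)
  show ?case
  proof
    assume one: "nim_value S x = 1"
    have "a \<le> x"
      using one nim_value_below[of S x] min by fastforce
    moreover have "nim_value S (x - a) = 0"
    proof (rule nim_value_eq_0)
      fix s assume s: "s \<in> S" "0 < s" "s \<le> x - a"
      have "x - a - s = x - s - a"
        by simp
      then show "nim_value S (x - a - s) \<noteq> 0"
        using less.IH[of "x - s"] nim_value_move[of s S x] s one \<open>a \<le> x\<close> assms(2) by auto
    qed
    ultimately show "a \<le> x \<and> nim_value S (x - a) = 0" ..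
  next
    assume R: "a \<le> x \<and> nim_value S (x - a) = 0"
    then have "nim_value S x \<noteq> 0"
      using nim_value_move[of a S x] assms by auto
    moreover have "\<not> 1 < nim_value S x"
    proof
      assume "1 < nim_value S x"
      then obtain s where s: "s \<in> S" "0 < s" "s \<le> x" "nim_value S (x - s) = 1"
        by (rule less_nim_value)
      with less.IH[of "x - s"] have "a \<le> x - s" "nim_value S (x - s - a) = 0"
        using \<open>0 < a\<close> by auto
      moreover from this(1) have "s \<le> x - a" "x - s - a = x - a - s"
        using \<open>s \<le> x\<close> by linarith+
      ultimately show False
        using nim_value_move[of s S "x - a"] s R by auto
    qed
    ultimately show "nim_value S x = 1"
      by linarith
  qed
qed

section \<open>Pure periods and the least period\<close>

lemma is_pure_period_mult:
  assumes "is_pure_period f p"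
  shows "f (x + k * p) = f x"
proof (induction k)
  case (Suc k)
  have "f (x + Suc k * p) = f ((x + k * p) + p)"
    by (simp add: algebra_simps)
  with Suc show ?case
    using assms by (simp add: is_pure_period_def)
qed simp

lemma is_pure_period_mod:
  assumes "is_pure_period f p"
  shows "f (x mod p) = f x"
  using is_pure_period_mult[OF assms, of "x mod p" "x div p"] by simp

text \<open>Otherwise the remainder \<open>q mod p\<close> would be a positive period smaller than
  \<open>p\<close>.\<close>

lemma least_period_dvd:
  assumes "purely_periodic_with_least_period f p" and "is_pure_period f q"
  shows "p dvd q"
proof (rule ccontr)
  assume ndvd: "\<not> p dvd q"
  have p: "is_pure_period f p"
    using assms(1) by (simp add: purely_periodic_with_least_period_def)
  have "f (x + q mod p) = f x" for x
  proof -
    have "f (x + q mod p) = f (x + q mod p + q div p * p)"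
      by (rule is_pure_period_mult[OF p, symmetric])
    also have "\<dots> = f (x + q)"
      by (simp only: add.assoc mod_div_mult_eq)
    finally show ?thesis
      using assms(2) by (simp add: is_pure_period_def)
  qed
  then have "is_pure_period f (q mod p)"
    using ndvd by (simp add: is_pure_period_def dvd_eq_mod_eq_0 Suc_le_eq)
  then have "p \<le> q mod p"
    using assms(1) by (simp add: purely_periodic_with_least_period_def)
  then show False
    using p by (simp add: is_pure_period_def not_less[symmetric])
qed

lemma ex_least_period:
  assumes "is_pure_period f q"
  obtains p where "purely_periodic_with_least_period f p" "p \<le> q"
  using LeastI[of "is_pure_period f" q] Least_le[of "is_pure_period f"] assms that
  unfolding purely_periodic_with_least_period_def by blast

section \<open>The two-move game \<open>{a, b}\<close>\<close>

context
  fixes a b :: nat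
  assumes a_pos: "0 < a" and a_less_b: "a < b"
begin

text \<open>The options of \<open>x + (a + b)\<close> are exactly \<open>x + a\<close> and
  \<open>x + b\<close>, both nonzero when \<open>x\<close> is a zero. If \<open>x\<close> is not a
  zero, a move \<open>s\<close> to a zero carries over by induction: the same \<open>s\<close> leads
  from \<open>x + (a + b)\<close> to a zero.\<close>

lemma pair_nim_value_zero_shift:
  "nim_value {a, b} (x + (a + b)) = 0 \<longleftrightarrow> nim_value {a, b} x = 0"
proof (induction x rule: less_induct)
  case (less x)
  let ?G = "nim_value {a, b}"
  have move: "?G y \<noteq> 0" if "s \<in> {a, b}" "s \<le> y" "?G (y - s) = 0" for s y
    using nim_value_move[of s "{a, b}" y] that a_pos a_less_b by auto
  show ?case
  proof (cases "?G x = 0")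
    case True
    then have "?G (x + a) \<noteq> 0" "?G (x + b) \<noteq> 0"
      using move[of a "x + a"] move[of b "x + b"] by auto
    then have "?G (x + (a + b)) = 0"
      by (intro nim_value_eq_0) (auto simp: add.assoc[symmetric] diff_add_assoc2)
    with True show ?thesis by simp
  next
    case False
    then obtain s where s: "s \<in> {a, b}" "0 < s" "s \<le> x" "?G (x - s) = 0"
      using less_nim_value[of 0 "{a, b}" x] by blast
    then have "?G (x - s + (a + b)) = 0"
      using less.IH[of "x - s"] by auto
    then have "?G (x + (a + b)) \<noteq> 0"
      using move[of s "x + (a + b)"] s by auto
    with False show ?thesis by simp
  qed
qed

lemma pair_nim_value_one:
  "nim_value {a, b} x = 1 \<longleftrightarrow> a \<le> x \<and> nim_value {a, b} (x - a) = 0"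
  using a_pos a_less_b by (intro ferguson_pairing) auto

text \<open>Such a position needs options of values 0 and 1 and has at most two options. By the
  pairing \<open>x - a\<close> cannot be the zero, which fixes who has which value; no option is
  left for the value 2.\<close>

lemma pair_nim_value_ge_2:
  assumes "2 \<le> nim_value {a, b} x"
  shows "b \<le> x" "nim_value {a, b} (x - a) = 1" "nim_value {a, b} (x - b) = 0"
    and "nim_value {a, b} x = 2"
proof -
  let ?G = "nim_value {a, b}"
  obtain s where s: "s \<in> {a, b}" "s \<le> x" "?G (x - s) = 0"
    using less_nim_value[of 0 "{a, b}" x] assms by auto
  obtain t where t: "t \<in> {a, b}" "t \<le> x" "?G (x - t) = 1"
    using less_nim_value[of 1 "{a, b}" x] assms by auto
  have not_a: "\<not> (a \<le> x \<and> ?G (x - a) = 0)"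
    using pair_nim_value_one[of x] assms by auto
  with s t show x: "b \<le> x" "?G (x - a) = 1" "?G (x - b) = 0"
    by auto
  have "\<not> 2 < ?G x"
  proof
    assume "2 < ?G x"
    then obtain u where "u \<in> {a, b}" "?G (x - u) = 2"
      by (rule less_nim_value)
    with x show False by auto
  qed
  with assms show "?G x = 2" by simp
qed

lemma pair_period: "is_pure_period (nim_value {a, b}) (a + b)"
proof -
  let ?G = "nim_value {a, b}"
  have "?G (x + (a + b)) = ?G x" for x
  proof -
    have zero: "?G (x + (a + b)) = 0 \<longleftrightarrow> ?G x = 0"
      by (rule pair_nim_value_zero_shift)
    have one: "?G (x + (a + b)) = 1 \<longleftrightarrow> ?G x = 1"
    proof (cases "a \<le> x")
      case True
      then have "x + (a + b) - a = x - a + (a + b)"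
        by simp
      with True show ?thesis
        using pair_nim_value_zero_shift[of "x - a"]
        by (simp only: pair_nim_value_one) auto
    next
      case False
      \<comment> \<open>Below \<open>a\<close> no move exists, so \<open>x\<close> and its shift are
        both zeros and neither has value 1.\<close>
      then have "?G x = 0"
        using a_less_b by (intro nim_value_below) auto
      with zero show ?thesis by simp
    qed
    have "?G y = 0 \<or> ?G y = 1 \<or> ?G y = 2" for y
      using pair_nim_value_ge_2(4)[of y] by linarith
    then show ?thesis
      using zero one by metis
  qed
  then show ?thesis
    using a_pos by (simp add: is_pure_period_def)
qed

lemma mod_in_P_residues:
  "x mod (a + b) \<in> P_residues a b \<longleftrightarrow> nim_value {a, b} x = 0"
  using is_pure_period_mod[OF pair_period, of x] a_pos
  by (simp add: P_residues_def P_positions_def)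

text \<open>Turns the condition on residues into one on play: no move by \<open>c\<close> joins two
  zeros of the pair game. Periodicity lets residues stand for all positions and
  \<open>c mod (a + b)\<close> for \<open>c\<close>.\<close>

lemma Theta_iff:
  "c mod (a + b) \<in> Theta a b \<longleftrightarrow>
    (\<forall>x. nim_value {a, b} x = 0 \<longrightarrow> nim_value {a, b} (x + c) \<noteq> 0)"
    (is "?\<rho> \<in> _ \<longleftrightarrow> ?R")
proof -
  have \<rho>: "?\<rho> < a + b"
    using a_pos by simp
  have shift: "(z + ?\<rho>) mod (a + b) \<in> P_residues a b \<longleftrightarrow> nim_value {a, b} (z + c) = 0" for z
    using mod_in_P_residues[of "z + c"] by (simp add: mod_add_right_eq)
  have "?\<rho> \<in> Theta a b \<longleftrightarrow>
      (\<forall>z\<in>P_residues a b. nim_value {a, b} (z + c) \<noteq> 0)"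
    using \<rho> shift by (auto simp: Theta_def translate_mod_def)
  also have "\<dots> \<longleftrightarrow> ?R"
  proof
    assume L: "\<forall>z\<in>P_residues a b. nim_value {a, b} (z + c) \<noteq> 0"
    show ?R
    proof (intro allI impI)
      fix x assume "nim_value {a, b} x = 0"
      then have "x mod (a + b) \<in> P_residues a b"
        by (simp only: mod_in_P_residues)
      with L have "nim_value {a, b} (x mod (a + b) + c) \<noteq> 0" ..
      then show "nim_value {a, b} (x + c) \<noteq> 0"
        unfolding mod_in_P_residues[symmetric] by (simp add: mod_add_left_eq)
    qed
  qed (auto simp: P_residues_def P_positions_def)
  finally show ?thesis .
qed

section \<open>Adding the third move \<open>c\<close>\<close>

lemma triple_nim_value_eq_pair:
  assumes "b < c" and sep: "\<And>x. nim_value {a, b} x = 0 \<Longrightarrow> nim_value {a, b} (x + c) \<noteq> 0"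
  shows "nim_value {a, b, c} = nim_value {a, b}"
proof
  fix x
  let ?G = "nim_value {a, b}" and ?H = "nim_value {a, b, c}"
  show "?H x = ?G x"
  proof (induction x rule: less_induct)
    case (less x)
    have IH: "?H (x - s) = ?G (x - s)" if "s \<in> {a, b, c}" "s \<le> x" for s
      using that a_pos a_less_b assms(1) by (intro less.IH) auto
    \<comment> \<open>By induction the option values in the pair game are among those in the triple
      game, and the mex is monotone.\<close>
    have le: "?G x \<le> ?H x"
    proof (rule ccontr)
      assume "\<not> ?G x \<le> ?H x"
      then have "?H x < ?G x" by simp
      then obtain s where "s \<in> {a, b}" "0 < s" "s \<le> x" "?G (x - s) = ?H x"
        by (rule less_nim_value)
      then show False
        using nim_value_move[of s "{a, b, c}" x] IH[of s] by auto
    qed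
    have "\<not> ?G x < ?H x"
    proof
      assume "?G x < ?H x"
      then obtain s where s: "s \<in> {a, b, c}" "0 < s" "s \<le> x" "?H (x - s) = ?G x"
        by (rule less_nim_value)
      then have eq: "?G (x - s) = ?G x"
        using IH by auto
      \<comment> \<open>Moves by \<open>a\<close> or \<open>b\<close> always change
        \<open>?G\<close>, so only \<open>c\<close> can preserve it.\<close>
      then have "s = c"
        using nim_value_move[of s "{a, b}" x] s by auto
      with s eq have c: "c \<le> x" "?G (x - c) = ?G x"
        by auto
      \<comment> \<open>Each value of \<open>?G\<close> is witnessed by a zero at a distance determined by the value.\<close>
      have sep': False if "d \<le> x - c" "?G (x - c - d) = 0" "?G (x - d) = 0" for d
        using sep[of "x - c - d"] that c(1) by simp
      consider "?G x = 0" | "?G x = 1" | "2 \<le> ?G x"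
        by linarith
      then show False
      proof cases
        case 1
        with c sep'[of 0] show False by simp
      next
        case 2
        with c pair_nim_value_one[of x] pair_nim_value_one[of "x - c"] sep'[of a]
        show False by simp
      next
        case 3
        with c pair_nim_value_ge_2[of x] pair_nim_value_ge_2[of "x - c"] sep'[of b]
        show False by simp
      qed
    qed
    with le show ?case by simp
  qed
qed

lemma short_period_imp_triple_eq_pair:
  assumes "2 * (a + b) \<le> c" and p: "is_pure_period (nim_value {a, b, c}) p" and "p \<le> a + b"
  shows "nim_value {a, b, c} = nim_value {a, b}"
proof
  fix x
  let ?G = "nim_value {a, b}" and ?H = "nim_value {a, b, c}"
  have below: "?H x = ?G x" if "x < c" for x
    using that by (intro nim_value_cong) auto
  have "?G (x + p) = ?G x" for x
  proof -
    \<comment> \<open>Passing to the residue puts both \<open>r\<close> and \<open>r + p\<close>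
      below \<open>2 * (a + b)\<close>, hence below \<open>c\<close>, where the two games agree and
      the period of \<open>?H\<close> can be read off for \<open>?G\<close>.\<close>
    define r where "r = x mod (a + b)"
    have r: "r < a + b"
      using a_pos by (simp add: r_def)
    with assms(1,3) have "r + p < c"
      by simp
    have "?G (x + p) = ?G ((r + p) mod (a + b))"
      using is_pure_period_mod[OF pair_period, of "x + p"] by (simp add: r_def mod_add_left_eq)
    also have "\<dots> = ?G (r + p)"
      by (rule is_pure_period_mod[OF pair_period])
    also have "\<dots> = ?H (r + p)"
      using \<open>r + p < c\<close> by (rule below[symmetric])
    also have "\<dots> = ?H r"
      using p by (simp add: is_pure_period_def)
    also have "\<dots> = ?G r"
      using \<open>r + p < c\<close> by (intro below) linarith
    also have "\<dots> = ?G x"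
      unfolding r_def by (rule is_pure_period_mod[OF pair_period])
    finally show ?thesis .
  qed
  then have G: "is_pure_period ?G p"
    using p by (simp add: is_pure_period_def)
  \<comment> \<open>Both functions now have period \<open>p\<close>, and \<open>[0, p)\<close> lies
    below \<open>c\<close>, so agreement there spreads to all positions.\<close>
  have "x mod p < p"
    using p by (simp add: is_pure_period_def)
  then have "?H (x mod p) = ?G (x mod p)"
    using assms by (intro below) simp
  then show "?H x = ?G x"
    by (simp only: is_pure_period_mod[OF p] is_pure_period_mod[OF G])
qed

end

theorem proposition55:
  fixes a b c \<rho> :: nat and S B :: "nat set"
  assumes "2 \<le> a" and "a < b" and "b < c" and "2 * (a + b) \<le> c"
    and "S = {a, b, c}" and "B = {a, b}" and "\<rho> = c mod (a + b)"
  shows "((\<exists>p. purely_periodic_with_least_period (nim_value S) p \<and> p \<le> a + b) \<longleftrightarrow>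
            \<rho> \<in> Theta a b) \<and>
         (\<forall>p. purely_periodic_with_least_period (nim_value S) p \<and> p \<le> a + b \<longrightarrow>
            P_positions S = P_positions B \<and>
            purely_periodic_with_least_period (nim_value B) p \<and>
            p dvd a + b)"
proof -
  have a: "0 < a"
    using assms(1) by simp
  note period = pair_period[OF a \<open>a < b\<close>, folded \<open>B = {a, b}\<close>]
  note Theta = Theta_iff[OF a \<open>a < b\<close>, of c, folded \<open>B = {a, b}\<close> \<open>\<rho> = c mod (a + b)\<close>]
  have eq: "nim_value S = nim_value B"
    if "purely_periodic_with_least_period (nim_value S) p" "p \<le> a + b" for p
    using short_period_imp_triple_eq_pair[OF a \<open>a < b\<close> assms(4), of p] that assms(5,6)
    by (simp add: purely_periodic_with_least_period_def)
  have "\<rho> \<in> Theta a b"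
    if "purely_periodic_with_least_period (nim_value S) p" "p \<le> a + b" for p
  proof -
    \<comment> \<open>In the triple game \<open>c\<close> is a legal move, so it never joins two
      zeros; equality of the games transfers this to the pair game.\<close>
    have "nim_value S (x + c) \<noteq> 0" if "nim_value S x = 0" for x
      using nim_value_move[of c S "x + c"] that assms(3,5) by auto
    then show ?thesis
      using Theta eq[OF that] by simp
  qed
  moreover have "\<exists>p. purely_periodic_with_least_period (nim_value S) p \<and> p \<le> a + b"
    if "\<rho> \<in> Theta a b"
  proof -
    have "nim_value S = nim_value B"
      using triple_nim_value_eq_pair[OF a \<open>a < b\<close> \<open>b < c\<close>] Theta that assms(5,6) by simp
    \<comment> \<open>The least period of the pair game is at most its period
      \<open>a + b\<close>.\<close>
    then show ?thesis
      using ex_least_period[OF period] by metis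
  qed
  moreover have "P_positions S = P_positions B \<and>
      purely_periodic_with_least_period (nim_value B) p \<and> p dvd a + b"
    if "purely_periodic_with_least_period (nim_value S) p" "p \<le> a + b" for p
    using eq[OF that] that least_period_dvd[OF _ period] by (simp add: P_positions_def)
  ultimately show ?thesis
    by blast
qed

end
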